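(* Let $n\ge 2$ and let $f_i:\mathbb{R}^n\to\mathbb{R}$, $f_i(x)=x^\top A_ix+2b_i^\top x+c_i$, $i\in[m]$, be quadratic functions with associated matrices $Q_i=\begin{bmatrix}A_i & b_i\\ b_i^\top & c_i\end{bmatrix}$. Let $S=\{x\in\mathbb{R}^n:f_i(x)<0,\ i\in[m]\}$. Assume that $Q_1,\ldots,Q_m$ are diagonal. Then: (1) $S=\emptyset$ if and only if there exists a nonzero $\lambda\ge0$ in $\mathbb{R}^m$ such that $\sum_{i=1}^m\lambda_iQ_i\succeq0$. (2) If $S\neq\emptyset$, then $\mathrm{conv}(S)\ne\mathbb{R}^n$ if and only if there exists $\lambda\ge0$ in $\mathbb{R}^m$ such that the leading $n\times n$ principal submatrix of $\sum_{i=1}^m\lambda_iQ_i$ is nonzero and positive semidefinite; equivalently, if and only if there exists a nonzero $\lambda\ge0$ such that the set $\{x:\sum_{i=1}^m\lambda_if_i(x)<0\}$ is convex and not equal to $\mathbb{R}^n$. (3) If $\emptyset\subsetneq\mathrm{conv}(S)\subsetneq\mathbb{R}^n$, then $\mathrm{conv}(S)$ is described by finitely many aggregations, each having positive semidefinite leading $n\times n$ principal submatrix; that is, there are finitely many $\lambda^{(1)},\ldots,\lambda^{(k)}\in\Omega$ such that $\mathrm{conv}(S)=\bigcap_{j=1}^kS_{\lambda^{(j)}}$ and the leading $n\times n$ principal submatrix of $Q_{\lambda^{(j)}}$ is positive semidefinite for every $j$.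
   Context: $[m]=\{1,\dots,m\}$; $A_i$ are symmetric real $n\times n$ matrices, $b_i\in\mathbb{R}^n$, $c_i\in\mathbb{R}$. Inequalities between vectors are componentwise. For $\lambda\in\mathbb{R}^m_+$ (nonnegative orthant): $Q_\lambda=\sum_{i=1}^m\lambda_iQ_i$ and $S_\lambda=\{x\in\mathbb{R}^n:\sum_{i=1}^m\lambda_if_i(x)<0\}$. $\Omega=\{\lambda\in\mathbb{R}^m_+\setminus\{0\}: \mathrm{conv}(S)\subseteq S_\lambda$ and $Q_\lambda$ has at most one negative eigenvalue$\}$ is the set of (good) aggregations. *)

theory Defs
  imports "HOL-Analysis.Analysis" "HOL-Computational_Algebra.Computational_Algebra"
begin

definition quad_fun :: "real^'n^'n \<Rightarrow> real^'n \<Rightarrow> real \<Rightarrow> real^'n \<Rightarrow> real" where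
  "quad_fun A b c x = x \<bullet> (A *v x) + 2 * (b \<bullet> x) + c"

(* The (n+1) x (n+1) block matrix [[A, b], [b^T, c]]. Its index type is 'n option: the
   indices Some i are the first n ones, None is the last one. *)
definition quad_mat :: "real^'n^'n \<Rightarrow> real^'n \<Rightarrow> real \<Rightarrow> real^'n option^'n option" where
  "quad_mat A b c = (\<chi> p q. case (p, q) of
       (Some i, Some j) \<Rightarrow> A $ i $ j
     | (Some i, None) \<Rightarrow> b $ i
     | (None, Some j) \<Rightarrow> b $ j
     | (None, None) \<Rightarrow> c)"

definition leading_block :: "real^'n option^'n option \<Rightarrow> real^'n^'n" where
  "leading_block Q = (\<chi> i j. Q $ Some i $ Some j)"

definition is_diagonal :: "real^'n^'n \<Rightarrow> bool" where
  "is_diagonal M \<longleftrightarrow> (\<forall>i j. i \<noteq> j \<longrightarrow> M $ i $ j = 0)"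

definition pos_semidef :: "real^'n^'n \<Rightarrow> bool" where
  "pos_semidef M \<longleftrightarrow> transpose M = M \<and> (\<forall>x. 0 \<le> x \<bullet> (M *v x))"

definition charpoly :: "real^'n^'n \<Rightarrow> real poly" where
  "charpoly M = det (\<chi> i j. (if i = j then [:0, 1:] else 0) - [:M $ i $ j:])"

(* Eigenvalues are counted with multiplicity. Only real roots of the characteristic
   polynomial are seen, which is no restriction for symmetric matrices. *)
definition num_neg_eigenvalues :: "real^'n^'n \<Rightarrow> nat" where
  "num_neg_eigenvalues M = size (filter_mset (\<lambda>e. e < 0) (proots (charpoly M)))"

definition sol_set :: "('m \<Rightarrow> real^'n \<Rightarrow> real) \<Rightarrow> (real^'n) set" where
  "sol_set f = {x. \<forall>i. f i x < 0}"

definition agg_mat :: "('m::finite \<Rightarrow> real^'k^'k) \<Rightarrow> real^'m \<Rightarrow> real^'k^'k" where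
  "agg_mat Q l = (\<Sum>i\<in>UNIV. (l $ i) *\<^sub>R Q i)"

definition agg_set :: "('m::finite \<Rightarrow> real^'n \<Rightarrow> real) \<Rightarrow> real^'m \<Rightarrow> (real^'n) set" where
  "agg_set f l = {x. (\<Sum>i\<in>UNIV. l $ i * f i x) < 0}"

(* The order on vectors is the library's componentwise one. *)
definition good_aggs ::
    "('m::finite \<Rightarrow> real^'n \<Rightarrow> real) \<Rightarrow> ('m \<Rightarrow> real^'n option^'n option) \<Rightarrow> (real^'m) set" where
  "good_aggs f Q = {l. 0 \<le> l \<and> l \<noteq> 0 \<and> convex hull (sol_set f) \<subseteq> agg_set f l
     \<and> num_neg_eigenvalues (agg_mat Q l) \<le> 1}"

end

theory Submission
  imports Defs
begin

text \<open>
  A quadratic function with diagonal matrix has no linear part and no mixed terms, so it is an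
  affine function of the vector \<open>y\<close> of squared coordinates. With \<open>D\<close> the matrix whose rows are the
  diagonals of the \<open>A i\<close>, and \<open>g\<close> the vector of constants, the system of strict inequalities says
  that \<open>y\<close> lies in the open polyhedron \<open>D y + g < 0\<close>, and as \<open>x\<close> varies \<open>y\<close> runs through the
  nonnegative orthant. A diagonal aggregation has the entries of \<open>l v* D\<close> and the number \<open>l \<bullet> g\<close> on its
  diagonal. Everything is therefore a question about linear inequalities.

  Emptiness of \<open>S\<close> is the linear alternative \<open>strict_system_alternative\<close>, a version of the lemmas of
  Gordan and Farkas: either \<open>D y + g < 0\<close> has a nonnegative solution, or some nonzero \<open>l \<ge> 0\<close> has
  \<open>l v* D \<ge> 0\<close> and \<open>l \<bullet> g \<ge> 0\<close>, which for a diagonal aggregation is positive semidefiniteness.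

  For the convex hull the key fact is \<open>convex_hull_vec_sq_vimage\<close>: passing to the hull replaces the
  condition that the squares form a point of \<open>P\<close> by the condition that they lie below a point of
  \<open>P\<close>. One inclusion holds because a box is the hull of its corners, which all have the same squares;
  the other because squaring is convex. Thus \<open>x\<close> lies in the hull of \<open>S\<close> iff, with \<open>y\<close> the squares of
  \<open>x\<close>, the system \<open>D (y + w) + g < 0\<close> has a solution \<open>w \<ge> 0\<close>, and the same alternative turns this
  into: every nonzero \<open>l \<ge> 0\<close> with \<open>l v* D \<ge> 0\<close> gives an aggregated inequality valid at \<open>x\<close>
  (\<open>convex_hull_diagonal_system\<close>). So the aggregations with positive semidefinite leading block
  describe the hull.

  These multipliers form a polyhedral cone, so finitely many of them generate it
  (\<open>psd_multipliers_finitely_generated\<close>) and their aggregations already cut out the hull. Each has at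
  most one negative eigenvalue, since only the corner entry can be negative. When \<open>S\<close> is nonempty, a
  multiplier that excludes some point has \<open>l v* D \<noteq> 0\<close>, because otherwise its aggregation would be
  constant, and negative at the points of \<open>S\<close>. Conversely, an aggregation with nonzero
  \<open>l \<ge> 0\<close> is valid on \<open>S\<close>; if its set is convex and proper, it contains the hull of \<open>S\<close>, which is
  then proper as well.
\<close>

(* The dollar sign is also the coefficient operator of formal power series. *)
no_notation fps_nth (infixl "$" 75)

section \<open>Strict linear systems on the nonnegative orthant\<close>

lemma nonneg_vec_iff: "0 \<le> (v::real^'k) \<longleftrightarrow> (\<forall>j. 0 \<le> v $ j)"
  by (simp add: less_eq_vec_def)

lemma inner_neg_of_nonneg_nonzero:
  fixes l v :: "real^'m"
  assumes "0 \<le> l" "l \<noteq> 0" "\<And>i. v $ i < 0"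
  shows "l \<bullet> v < 0"
proof -
  obtain i where "l $ i \<noteq> 0"
    using assms(2) by (auto simp: vec_eq_iff)
  then have i: "0 < l $ i"
    using assms(1) by (simp add: nonneg_vec_iff order.strict_iff_order)
  have "0 < (\<Sum>i\<in>UNIV. l $ i * - v $ i)"
  proof (rule sum_pos2[of _ i])
    show "0 < l $ i * - v $ i"
      using assms(3)[of i] i by (simp add: mult_pos_neg)
    show "0 \<le> l $ j * - v $ j" for j
      using assms(1) assms(3)[of j] by (simp add: nonneg_vec_iff mult_nonneg_nonpos)
  qed auto
  then show ?thesis
    by (simp add: inner_vec_def sum_negf)
qed

lemma inner_nonneg_vec:
  fixes l v :: "real^'m"
  assumes "0 \<le> l" "0 \<le> v"
  shows "0 \<le> l \<bullet> v"
  using assms by (simp add: inner_vec_def nonneg_vec_iff sum_nonneg)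

text \<open>
  A ray that stays nonnegative cannot have negative slope. Each sign condition on a separating
  hyperplane below is read off from such a ray.
\<close>

lemma nonneg_linear_coeff:
  fixes p q :: real
  assumes "\<And>t. 0 \<le> t \<Longrightarrow> 0 \<le> t * p + q"
  shows "0 \<le> p"
proof (rule ccontr)
  assume "\<not> 0 \<le> p"
  then have "0 \<le> ((\<bar>q\<bar> + 1) / - p) * p + q"
    by (intro assms divide_nonneg_pos) auto
  moreover have "((\<bar>q\<bar> + 1) / - p) * p = - (\<bar>q\<bar> + 1)"
    using \<open>\<not> 0 \<le> p\<close> by (simp add: field_simps)
  ultimately show False by linarith
qed

text \<open>
  Both alternatives cannot hold, since pairing a solution with a multiplier gives a number that is
  negative and nonnegative. If the system is unsolvable, then 0 is outside the convex set \<open>C\<close> of all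
  vectors strictly above some \<open>D *v w + g\<close>, and the normal of a hyperplane separating 0 from \<open>C\<close> is
  the multiplier: \<open>C\<close> is closed under increasing a coordinate, which gives \<open>0 \<le> l\<close>, and under
  moving \<open>w\<close> along a coordinate ray, which gives \<open>0 \<le> l v* D\<close>.
\<close>

theorem strict_system_alternative:
  fixes D :: "real^'n^'m" and g :: "real^'m"
  shows "(\<exists>w. 0 \<le> w \<and> (\<forall>i. (D *v w + g) $ i < 0)) \<longleftrightarrow>
    \<not> (\<exists>l. 0 \<le> l \<and> l \<noteq> 0 \<and> 0 \<le> l v* D \<and> 0 \<le> l \<bullet> g)"
proof (intro iffI notI)
  assume "\<exists>w. 0 \<le> w \<and> (\<forall>i. (D *v w + g) $ i < 0)"
  then obtain w where w: "0 \<le> w" "\<And>i. (D *v w + g) $ i < 0" by blast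
  assume "\<exists>l. 0 \<le> l \<and> l \<noteq> 0 \<and> 0 \<le> l v* D \<and> 0 \<le> l \<bullet> g"
  then obtain l where l: "0 \<le> l" "l \<noteq> 0" "0 \<le> l v* D" "0 \<le> l \<bullet> g" by blast
  have "l \<bullet> (D *v w + g) < 0"
    by (rule inner_neg_of_nonneg_nonzero) (use l w in auto)
  moreover have "l \<bullet> (D *v w + g) = (l v* D) \<bullet> w + l \<bullet> g"
    by (simp add: inner_add_right dot_lmul_matrix)
  ultimately show False
    using inner_nonneg_vec[OF l(3) w(1)] l(4) by linarith
next
  assume no_mult: "\<not> (\<exists>l. 0 \<le> l \<and> l \<noteq> 0 \<and> 0 \<le> l v* D \<and> 0 \<le> l \<bullet> g)"
  show "\<exists>w. 0 \<le> w \<and> (\<forall>i. (D *v w + g) $ i < 0)"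
  proof (rule ccontr)
    assume unsolvable: "\<not> (\<exists>w. 0 \<le> w \<and> (\<forall>i. (D *v w + g) $ i < 0))"
    define C where "C = {v. \<exists>w. 0 \<le> w \<and> (\<forall>i. (D *v w + g) $ i < v $ i)}"
    have "convex C"
    proof (rule convexI)
      fix v v' :: "real^'m" and s t :: real
      assume "v \<in> C" "v' \<in> C" and st: "0 \<le> s" "0 \<le> t" "s + t = 1"
      then obtain w w' where w: "0 \<le> w" "\<And>i. (D *v w + g) $ i < v $ i"
        and w': "0 \<le> w'" "\<And>i. (D *v w' + g) $ i < v' $ i"
        by (auto simp: C_def)
      have "(D *v (s *\<^sub>R w + t *\<^sub>R w') + g) $ i < (s *\<^sub>R v + t *\<^sub>R v') $ i" for i
      proof -
        have "(D *v (s *\<^sub>R w + t *\<^sub>R w') + g) $ i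
            = s * (D *v w) $ i + t * (D *v w') $ i + (s + t) * g $ i"
          by (simp add: st(3) matrix_vector_right_distrib matrix_vector_mult_scaleR)
        also have "\<dots> = s * (D *v w + g) $ i + t * (D *v w' + g) $ i"
          by (simp add: algebra_simps)
        also have "\<dots> < s * v $ i + t * v' $ i"
        proof (cases "s = 0")
          case True
          then show ?thesis using w'(2)[of i] st by simp
        next
          case False
          then have "s * (D *v w + g) $ i < s * v $ i"
            using w(2)[of i] st by (intro mult_strict_left_mono) auto
          moreover have "t * (D *v w' + g) $ i \<le> t * v' $ i"
            using w'(2)[of i] st by (intro mult_left_mono) auto
          ultimately show ?thesis by linarith
        qed
        finally show ?thesis by simp
      qed
      moreover have "0 \<le> s *\<^sub>R w + t *\<^sub>R w'"
        using w(1) w'(1) st by (simp add: nonneg_vec_iff)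
      ultimately show "s *\<^sub>R v + t *\<^sub>R v' \<in> C"
        unfolding C_def by blast
    qed
    moreover have "0 \<notin> C"
      using unsolvable by (simp add: C_def)
    ultimately have "\<exists>l. l \<noteq> 0 \<and> (\<forall>v\<in>C. 0 \<le> l \<bullet> v)"
      by (rule separating_hyperplane_set_0)
    then obtain l where l0: "l \<noteq> 0" and l: "\<And>v. v \<in> C \<Longrightarrow> 0 \<le> l \<bullet> v"
      by blast
    have inC: "D *v w + g + u \<in> C" if "0 \<le> w" "\<And>i. 0 < u $ i" for w and u :: "real^'m"
      using that by (auto simp: C_def)
    (* In each of the next arguments, the summand with positive entries after g is the slack
       that turns D *v w + g into a point of C. *)
    have "0 \<le> l $ i" for i
    proof (rule nonneg_linear_coeff)
      fix t :: real
      assume "0 \<le> t"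
      then have "0 \<le> l \<bullet> (D *v 0 + g + (1 + t *\<^sub>R axis i 1))"
        by (intro l inC) (auto simp: axis_def intro: add_pos_nonneg)
      then show "0 \<le> t * l $ i + l \<bullet> (g + 1)"
        by (simp add: inner_add_right inner_axis algebra_simps)
    qed
    then have l_nonneg: "0 \<le> l" by (simp add: nonneg_vec_iff)
    have "0 \<le> (l v* D) $ j" for j
    proof (rule nonneg_linear_coeff)
      fix t :: real
      assume "0 \<le> t"
      then have "0 \<le> l \<bullet> (D *v (t *\<^sub>R axis j 1) + g + 1)"
        by (intro l inC) (auto simp: axis_def nonneg_vec_iff)
      then show "0 \<le> t * (l v* D) $ j + l \<bullet> (g + 1)"
        by (simp add: inner_add_right dot_lmul_matrix[symmetric] inner_axis)
    qed
    then have "0 \<le> l v* D" by (simp add: nonneg_vec_iff)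
    moreover have "0 \<le> l \<bullet> g"
    proof (rule nonneg_linear_coeff)
      fix t :: real
      assume "0 \<le> t"
      (* Letting the slack tend to 0 gives the claim; with slack 1 / (t + 1), multiplying by t + 1
         puts the limit into the form of a ray. *)
      have "0 \<le> l \<bullet> (D *v 0 + g + (1 / (t + 1)) *\<^sub>R 1)"
        using \<open>0 \<le> t\<close> by (intro l inC) auto
      then have "0 \<le> (t + 1) * (l \<bullet> g + (1 / (t + 1)) * (l \<bullet> 1))"
        using \<open>0 \<le> t\<close> by (simp add: inner_add_right)
      also have "\<dots> = t * (l \<bullet> g) + (l \<bullet> g + l \<bullet> 1)"
        using \<open>0 \<le> t\<close> by (simp add: field_simps)
      finally show "0 \<le> t * (l \<bullet> g) + (l \<bullet> g + l \<bullet> 1)" .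
    qed
    ultimately show False using no_mult l0 l_nonneg by blast
  qed
qed

section \<open>Convex hulls of preimages under coordinatewise squaring\<close>

definition vec_sq :: "real^'n \<Rightarrow> real^'n" where
  "vec_sq x = (\<chi> j. (x $ j)\<^sup>2)"

lemma vec_sq_nonneg: "0 \<le> vec_sq x"
  by (simp add: vec_sq_def nonneg_vec_iff)

lemma nonneg_is_vec_sq:
  assumes "0 \<le> w"
  obtains x where "vec_sq x = w"
proof
  show "vec_sq (\<chi> j. sqrt (w $ j)) = w"
    using assms by (simp add: vec_sq_def vec_eq_iff nonneg_vec_iff)
qed

text \<open>
  The vectors with squares \<open>y\<close> are the corners of the box with half-widths \<open>sqrt (y $ j)\<close>, and \<open>x\<close>
  lies in this box. A hyperplane strictly separating \<open>x\<close> from the corners is impossible, because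
  on the box a linear functional is minimal at the corner whose signs oppose its coefficients.
\<close>

lemma vec_sq_le_imp_in_hull:
  fixes x y :: "real^'n"
  assumes le: "vec_sq x \<le> y"
  shows "x \<in> convex hull {v. vec_sq v = y}"
proof -
  define corner where "corner J = (\<chi> j. if j \<in> J then sqrt (y $ j) else - sqrt (y $ j))"
    for J :: "'n set"
  have abs_le: "\<bar>x $ j\<bar> \<le> sqrt (y $ j)" for j
    using le by (intro real_le_rsqrt) (simp add: less_eq_vec_def vec_sq_def)
  have y_nonneg: "0 \<le> y" using order_trans[OF vec_sq_nonneg le] .
  have "x \<in> convex hull (range corner)"
  proof (rule ccontr)
    assume "x \<notin> convex hull (range corner)"
    moreover have "closed (convex hull (range corner))"
      by (simp add: compact_imp_closed finite_imp_compact_convex_hull)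
    ultimately obtain a \<beta> where
      a: "a \<bullet> x < \<beta>" "\<And>v. v \<in> convex hull (range corner) \<Longrightarrow> \<beta> < a \<bullet> v"
      using separating_hyperplane_closed_point[OF convex_convex_hull] by blast
    have "a \<bullet> corner {j. a $ j < 0} \<le> a \<bullet> x"
      unfolding inner_vec_def
    proof (rule sum_mono)
      fix j
      show "a $ j \<bullet> corner {j. a $ j < 0} $ j \<le> a $ j \<bullet> x $ j"
      proof (cases "a $ j < 0")
        case True
        then show ?thesis
          using abs_le[of j] by (simp add: corner_def)
      next
        case False
        then have "a $ j * - sqrt (y $ j) \<le> a $ j * x $ j"
          using abs_le[of j] by (intro mult_left_mono) auto
        then show ?thesis
          using False by (simp add: corner_def)
      qed
    qed
    moreover have "\<beta> < a \<bullet> corner {j. a $ j < 0}"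
      by (rule a(2)) (simp add: hull_inc)
    ultimately show False using a(1) by linarith
  qed
  moreover have "range corner \<subseteq> {v. vec_sq v = y}"
    using y_nonneg by (auto simp: corner_def vec_sq_def vec_eq_iff nonneg_vec_iff)
  ultimately show ?thesis
    using hull_mono by blast
qed

text \<open>
  The right-hand side is convex because \<open>t \<mapsto> t\<^sup>2\<close> is convex in every coordinate and \<open>P\<close> is convex.
  It is the smallest such set because each of its points lies in a box whose corners have their
  squares in \<open>P\<close>.
\<close>

theorem convex_hull_vec_sq_vimage:
  fixes P :: "(real^'n) set"
  assumes "convex P"
  shows "convex hull {x. vec_sq x \<in> P} = {x. \<exists>y\<in>P. vec_sq x \<le> y}" (is "_ = ?D")
proof (rule hull_unique)
  show "{x. vec_sq x \<in> P} \<subseteq> ?D" by blast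
  show "convex ?D"
  proof (rule convexI)
    fix x x' :: "real^'n" and s t :: real
    assume "x \<in> ?D" "x' \<in> ?D" and st: "0 \<le> s" "0 \<le> t" "s + t = 1"
    then obtain y y' where y: "y \<in> P" "vec_sq x \<le> y" "y' \<in> P" "vec_sq x' \<le> y'" by blast
    have "(s * x $ j + t * x' $ j)\<^sup>2 \<le> s * y $ j + t * y' $ j" for j
    proof -
      have "s * (x $ j)\<^sup>2 + t * (x' $ j)\<^sup>2 - (s * x $ j + t * x' $ j)\<^sup>2
          = s * t * (x $ j - x' $ j)\<^sup>2"
      proof -
        have "t = 1 - s" using st(3) by simp
        show ?thesis unfolding \<open>t = 1 - s\<close> by algebra
      qed
      moreover have "0 \<le> s * t * (x $ j - x' $ j)\<^sup>2" using st by simp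
      moreover have "s * (x $ j)\<^sup>2 \<le> s * y $ j" "t * (x' $ j)\<^sup>2 \<le> t * y' $ j"
        using y st by (auto simp: less_eq_vec_def vec_sq_def intro: mult_left_mono)
      ultimately show ?thesis by linarith
    qed
    then have "vec_sq (s *\<^sub>R x + t *\<^sub>R x') \<le> s *\<^sub>R y + t *\<^sub>R y'"
      by (simp add: less_eq_vec_def vec_sq_def)
    moreover have "s *\<^sub>R y + t *\<^sub>R y' \<in> P"
      using assms y st by (simp add: convexD)
    ultimately show "s *\<^sub>R x + t *\<^sub>R x' \<in> ?D" by blast
  qed
next
  fix T :: "(real^'n) set"
  assume T: "{x. vec_sq x \<in> P} \<subseteq> T" "convex T"
  show "?D \<subseteq> T"
  proof
    fix x
    assume "x \<in> ?D"
    then obtain y where y: "y \<in> P" "vec_sq x \<le> y" by blast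
    then have "{v. vec_sq v = y} \<subseteq> T" using T(1) by blast
    then have "convex hull {v. vec_sq v = y} \<subseteq> T" using T(2) by (rule hull_minimal)
    then show "x \<in> T" using vec_sq_le_imp_in_hull[OF y(2)] by blast
  qed
qed

section \<open>Aggregations with positive semidefinite leading block\<close>

definition psd_multipliers :: "real^'n^'m \<Rightarrow> (real^'m) set" where
  "psd_multipliers D = {l. 0 \<le> l \<and> l \<noteq> 0 \<and> 0 \<le> l v* D}"

lemma convex_strict_polyhedron:
  fixes D :: "real^'n^'m"
  shows "convex {y. \<forall>i. (D *v y + g) $ i < 0}"
proof -
  have "{y. \<forall>i. (D *v y + g) $ i < 0} = (\<Inter>i. {y. (D $ i) \<bullet> y < - g $ i})"
    by (auto simp: matrix_vector_mult_def inner_vec_def) (smt (verit) UNIV_I)+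
  then show ?thesis
    by (auto intro: convex_INT convex_halfspace_lt)
qed

text \<open>
  A point above \<open>vec_sq x\<close> is \<open>vec_sq x + w\<close> with \<open>w \<ge> 0\<close>, so membership in the hull is solvability
  of a system in \<open>w\<close> with constant vector \<open>D *v vec_sq x + g\<close>. The multipliers of that system refute
  membership exactly when they violate the right-hand side.
\<close>

theorem convex_hull_diagonal_system:
  fixes D :: "real^'n^'m"
  shows "x \<in> convex hull {x. \<forall>i. (D *v vec_sq x + g) $ i < 0} \<longleftrightarrow>
    (\<forall>l\<in>psd_multipliers D. l \<bullet> (D *v vec_sq x + g) < 0)"
proof -
  have "x \<in> convex hull {x. \<forall>i. (D *v vec_sq x + g) $ i < 0} \<longleftrightarrow>
      (\<exists>y. vec_sq x \<le> y \<and> (\<forall>i. (D *v y + g) $ i < 0))"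
    using convex_hull_vec_sq_vimage[OF convex_strict_polyhedron[of D g]] by auto
  also have "\<dots> \<longleftrightarrow> (\<exists>w. 0 \<le> w \<and> (\<forall>i. (D *v w + (D *v vec_sq x + g)) $ i < 0))"
  proof
    assume "\<exists>y. vec_sq x \<le> y \<and> (\<forall>i. (D *v y + g) $ i < 0)"
    then obtain y where "vec_sq x \<le> y" "\<forall>i. (D *v y + g) $ i < 0" by blast
    then show "\<exists>w. 0 \<le> w \<and> (\<forall>i. (D *v w + (D *v vec_sq x + g)) $ i < 0)"
      by (intro exI[of _ "y - vec_sq x"])
        (simp add: less_eq_vec_def matrix_vector_mult_diff_distrib)
  next
    assume "\<exists>w. 0 \<le> w \<and> (\<forall>i. (D *v w + (D *v vec_sq x + g)) $ i < 0)"
    then obtain w where "0 \<le> w" "\<forall>i. (D *v w + (D *v vec_sq x + g)) $ i < 0" by blast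
    then show "\<exists>y. vec_sq x \<le> y \<and> (\<forall>i. (D *v y + g) $ i < 0)"
      by (intro exI[of _ "w + vec_sq x"])
        (simp add: less_eq_vec_def matrix_vector_right_distrib add.assoc)
  qed
  also have "\<dots> \<longleftrightarrow> (\<forall>l\<in>psd_multipliers D. l \<bullet> (D *v vec_sq x + g) < 0)"
    unfolding strict_system_alternative psd_multipliers_def by (auto simp: not_le)
  finally show ?thesis .
qed

text \<open>
  The slice \<open>B\<close> of the multiplier cone on which the coordinates sum to 1 is a bounded polyhedron,
  hence the hull of a finite set \<open>V\<close>. Every nonzero multiplier can be scaled into this slice.
\<close>

lemma psd_multipliers_finitely_generated:
  fixes D :: "real^'n^'m"
  obtains V where "finite V" "V \<subseteq> psd_multipliers D"
    "\<And>l. l \<in> psd_multipliers D \<Longrightarrow> \<exists>s>0. s *\<^sub>R l \<in> convex hull V"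
proof -
  define B where "B = {l::real^'m. 0 \<le> l \<and> 0 \<le> l v* D \<and> l \<bullet> 1 = 1}"
  have total: "l \<bullet> 1 = (\<Sum>i\<in>UNIV. l $ i)" for l :: "real^'m"
    by (simp add: inner_vec_def)
  have column: "(D *v axis j 1) \<bullet> l = (l v* D) $ j" for j l
  proof -
    have "(D *v axis j 1) \<bullet> l = l \<bullet> (D *v axis j 1)" by (rule inner_commute)
    also have "\<dots> = (l v* D) \<bullet> axis j 1" by (simp only: dot_lmul_matrix)
    finally show ?thesis by (simp add: inner_axis)
  qed
  have "B = (\<Inter>i. {l. axis i 1 \<bullet> l \<ge> 0}) \<inter>
      (\<Inter>j. {l. (D *v axis j 1) \<bullet> l \<ge> 0}) \<inter> {l. 1 \<bullet> l = 1}"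
    unfolding B_def column inner_axis' nonneg_vec_iff inner_commute[of _ 1] by auto
  moreover have "polyhedron \<dots>"
    by (intro polyhedron_Int polyhedron_Inter polyhedron_hyperplane finite_imageI finite)
      (auto intro: polyhedron_halfspace_ge)
  ultimately have "polyhedron B" by simp
  moreover have "bounded B"
    unfolding bounded_iff
  proof (intro exI ballI)
    fix l assume "l \<in> B"
    then have "0 \<le> l" "(\<Sum>i\<in>UNIV. l $ i) = 1" by (auto simp: B_def total)
    then show "norm l \<le> 1"
      using norm_le_l1_cart[of l] by (simp add: nonneg_vec_iff)
  qed
  ultimately have "polytope B"
    by (simp add: polytope_eq_bounded_polyhedron)
  then obtain V where V: "finite V" "B = convex hull V"
    by (auto simp: polytope_def)
  have "V \<subseteq> psd_multipliers D"
  proof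
    fix v assume "v \<in> V"
    then have "v \<in> B" unfolding V(2) by (rule hull_inc)
    then have "0 \<le> v" "0 \<le> v v* D" "v \<bullet> 1 = 1" by (simp_all add: B_def)
    moreover from this(3) have "v \<noteq> 0" by (metis inner_zero_left zero_neq_one)
    ultimately show "v \<in> psd_multipliers D" by (simp add: psd_multipliers_def)
  qed
  moreover have "\<exists>s>0. s *\<^sub>R l \<in> convex hull V" if l: "l \<in> psd_multipliers D" for l
  proof (intro exI conjI)
    have "l \<bullet> (-1) < 0"
      using l by (intro inner_neg_of_nonneg_nonzero) (auto simp: psd_multipliers_def)
    then have pos: "0 < l \<bullet> 1" by simp
    then show "0 < 1 / (l \<bullet> 1)" by simp
    have "((1 / (l \<bullet> 1)) *\<^sub>R l) v* D = (1 / (l \<bullet> 1)) *\<^sub>R (l v* D)"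
      by (rule scaleR_vector_matrix_assoc)
    then have "(1 / (l \<bullet> 1)) *\<^sub>R l \<in> B"
      using l pos by (simp add: B_def psd_multipliers_def nonneg_vec_iff)
    then show "(1 / (l \<bullet> 1)) *\<^sub>R l \<in> convex hull V" by (simp add: V(2))
  qed
  ultimately show thesis using V(1) that by blast
qed

text \<open>
  The half-space \<open>P\<close> has a nonnegative normal and is therefore downward closed, so replacing \<open>vec_sq x \<in> P\<close>
  by domination by a point of \<open>P\<close> changes nothing: the set equals its own convex hull.
\<close>

lemma convex_psd_multiplier_sublevel:
  fixes D :: "real^'n^'m"
  assumes "0 \<le> l v* D"
  shows "convex {x. l \<bullet> (D *v vec_sq x + g) < 0}" (is "convex ?T")
proof -
  define P where "P = {y. (l v* D) \<bullet> y < - (l \<bullet> g)}"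
  have T_eq: "?T = {x. vec_sq x \<in> P}"
    by (auto simp: P_def inner_add_right dot_lmul_matrix)
  have down: "z \<in> P" if "z \<le> y" "y \<in> P" for y z
  proof -
    have "0 \<le> (l v* D) \<bullet> (y - z)"
      using that by (intro inner_nonneg_vec assms) simp
    then show ?thesis using that(2) by (simp add: P_def inner_diff_right)
  qed
  have "convex P" unfolding P_def by (rule convex_halfspace_lt)
  then have "convex hull {x. vec_sq x \<in> P} = {x. vec_sq x \<in> P}"
    unfolding convex_hull_vec_sq_vimage[OF \<open>convex P\<close>] using down by blast
  then show ?thesis
    unfolding T_eq using convex_convex_hull by metis
qed

lemma psd_multiplier_sublevel_neq_UNIV:
  fixes D :: "real^'n^'m"
  assumes "0 \<le> l v* D" "l v* D \<noteq> 0"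
  shows "{x. l \<bullet> (D *v vec_sq x + g) < 0} \<noteq> UNIV"
proof -
  obtain j where "(l v* D) $ j \<noteq> 0" using assms(2) by (auto simp: vec_eq_iff)
  then have pos: "0 < (l v* D) $ j"
    using assms(1) by (simp add: nonneg_vec_iff order.strict_iff_order)
  define w where "w = (\<bar>l \<bullet> g\<bar> / (l v* D) $ j) *\<^sub>R axis j (1::real)"
  have "0 \<le> w"
    using pos by (auto simp: w_def nonneg_vec_iff axis_def)
  then obtain x where x: "vec_sq x = w" using nonneg_is_vec_sq by blast
  have "(l v* D) \<bullet> w = \<bar>l \<bullet> g\<bar>"
    using pos by (simp add: w_def inner_axis)
  then have "0 \<le> l \<bullet> (D *v vec_sq x + g)"
    by (simp add: x inner_add_right dot_lmul_matrix[symmetric])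
  then show ?thesis by (auto simp: not_less[symmetric])
qed

section \<open>Diagonal matrices\<close>

lemma pos_semidef_diagonal_iff:
  assumes "is_diagonal M"
  shows "pos_semidef M \<longleftrightarrow> (\<forall>p. 0 \<le> M $ p $ p)"
proof -
  have form: "x \<bullet> (M *v x) = (\<Sum>p\<in>UNIV. M $ p $ p * (x $ p)\<^sup>2)" for x
  proof -
    have "(M *v x) $ p = M $ p $ p * x $ p" for p
    proof -
      have "(M *v x) $ p = (\<Sum>q\<in>UNIV. if q = p then M $ p $ p * x $ p else 0)"
        unfolding matrix_vector_mult_def vec_lambda_beta
        by (rule sum.cong) (use assms in \<open>auto simp: is_diagonal_def\<close>)
      then show ?thesis by simp
    qed
    then show ?thesis
      by (simp add: inner_vec_def power2_eq_square mult_ac)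
  qed
  have "transpose M = M"
    using assms unfolding is_diagonal_def transpose_def vec_eq_iff by (metis vec_lambda_beta)
  moreover have "0 \<le> M $ p $ p" if "\<forall>x. 0 \<le> x \<bullet> (M *v x)" for p
  proof -
    have "0 \<le> axis p 1 \<bullet> (M *v axis p 1)" using that by blast
    also have "\<dots> = (\<Sum>q\<in>UNIV. if q = p then M $ p $ p else 0)"
      unfolding form by (intro sum.cong) (auto simp: axis_def)
    finally show ?thesis by simp
  qed
  ultimately show ?thesis
    unfolding pos_semidef_def by (auto simp: form intro!: sum_nonneg)
qed

text \<open>
  The characteristic polynomial splits into the linear factors given by the diagonal entries, so
  the multiset of roots is the multiset of these entries.
\<close>

lemma num_neg_eigenvalues_diagonal:
  assumes "is_diagonal M"
  shows "num_neg_eigenvalues M = card {p. M $ p $ p < 0}"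
proof -
  have "charpoly M = (\<Prod>p\<in>UNIV. [:- (M $ p $ p), 1:])"
    unfolding charpoly_def using assms
    by (subst det_diagonal) (auto simp: is_diagonal_def)
  then have "proots (charpoly M) = (\<Sum>p\<in>UNIV. {#M $ p $ p#})"
    by (simp add: proots_prod)
  moreover have "size (filter_mset (\<lambda>e. e < 0) (\<Sum>p\<in>F. {#M $ p $ p#})) =
      card {p \<in> F. M $ p $ p < 0}" if "finite F" for F
    using that
  proof (induction F)
    case (insert q F)
    have "{p \<in> insert q F. M $ p $ p < 0} =
        (if M $ q $ q < 0 then insert q {p \<in> F. M $ p $ p < 0} else {p \<in> F. M $ p $ p < 0})"
      by auto
    then show ?case using insert by simp
  qed simp
  ultimately show ?thesis by (simp add: num_neg_eigenvalues_def)
qed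

section \<open>Convex hulls of diagonal quadratic systems\<close>

theorem theorem2p12:
  fixes A :: "'m::finite \<Rightarrow> real^'n^'n"
    and b :: "'m \<Rightarrow> real^'n"
    and c :: "'m \<Rightarrow> real"
    and f :: "'m \<Rightarrow> real^'n \<Rightarrow> real"
    and Q :: "'m \<Rightarrow> real^'n option^'n option"
    and S :: "(real^'n) set"
  assumes n_ge_2: "CARD('n) \<ge> 2"
    and A_sym: "\<And>i. transpose (A i) = A i"
    and f_eq: "\<And>i x. f i x = quad_fun (A i) (b i) (c i) x"
    and Q_eq: "\<And>i. Q i = quad_mat (A i) (b i) (c i)"
    and S_eq: "S = sol_set f"
    and diag: "\<And>i. is_diagonal (Q i)"
  shows
    "(S = {} \<longleftrightarrow> (\<exists>l::real^'m. 0 \<le> l \<and> l \<noteq> 0 \<and> pos_semidef (agg_mat Q l)))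
   \<and> (S \<noteq> {} \<longrightarrow>
        (convex hull S \<noteq> UNIV \<longleftrightarrow>
           (\<exists>l::real^'m. 0 \<le> l \<and> leading_block (agg_mat Q l) \<noteq> 0
              \<and> pos_semidef (leading_block (agg_mat Q l))))
      \<and> (convex hull S \<noteq> UNIV \<longleftrightarrow>
           (\<exists>l::real^'m. 0 \<le> l \<and> l \<noteq> 0 \<and> convex (agg_set f l) \<and> agg_set f l \<noteq> UNIV)))
   \<and> ({} \<subset> convex hull S \<and> convex hull S \<subset> UNIV \<longrightarrow>
        (\<exists>L::(real^'m) set. finite L \<and> L \<subseteq> good_aggs f Q
           \<and> (\<forall>l\<in>L. pos_semidef (leading_block (agg_mat Q l)))
           \<and> convex hull S = (\<Inter>l\<in>L. agg_set f l)))"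
proof -
  define D :: "real^'n^'m" where "D = (\<chi> i j. A i $ j $ j)"
  define g :: "real^'m" where "g = (\<chi> i. c i)"
  have Q_off: "Q i $ p $ q = 0" if "p \<noteq> q" for i p q
    using diag that by (simp add: is_diagonal_def)
  have A_off: "A i $ j $ k = 0" if "j \<noteq> k" for i j k
    using Q_off[of "Some j" "Some k" i] that by (simp add: Q_eq quad_mat_def)
  have b_zero: "b i $ j = 0" for i j
    using Q_off[of "Some j" None i] by (simp add: Q_eq quad_mat_def)
  have f_sq: "f i x = (D *v vec_sq x + g) $ i" for i x
  proof -
    have "(A i *v x) $ j = A i $ j $ j * x $ j" for j
    proof -
      have "(A i *v x) $ j = (\<Sum>k\<in>UNIV. if k = j then A i $ j $ j * x $ j else 0)"
        unfolding matrix_vector_mult_def vec_lambda_beta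
        by (rule sum.cong) (use A_off in auto)
      then show ?thesis by simp
    qed
    then show ?thesis
      by (simp add: f_eq quad_fun_def b_zero inner_vec_def D_def g_def vec_sq_def
          matrix_vector_mult_def power2_eq_square mult_ac)
  qed
  have S_sq: "S = {x. \<forall>i. (D *v vec_sq x + g) $ i < 0}"
    by (simp add: S_eq sol_set_def f_sq)
  have agg_sq: "agg_set f l = {x. l \<bullet> (D *v vec_sq x + g) < 0}" for l
    by (simp add: agg_set_def f_sq inner_vec_def)

  have agg_entry: "agg_mat Q l $ p $ q = (\<Sum>i\<in>UNIV. l $ i * Q i $ p $ q)" for l p q
    by (simp add: agg_mat_def)
  have agg_diag: "is_diagonal (agg_mat Q l)" for l
    using diag by (simp add: is_diagonal_def agg_entry)
  then have block_diag: "is_diagonal (leading_block (agg_mat Q l))" for l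
    by (simp add: is_diagonal_def leading_block_def)
  have agg_Some: "agg_mat Q l $ Some j $ Some j = (l v* D) $ j" for l j
    by (simp add: agg_entry Q_eq quad_mat_def D_def vector_matrix_mult_def mult.commute)
  have agg_None: "agg_mat Q l $ None $ None = l \<bullet> g" for l
    by (simp add: agg_entry Q_eq quad_mat_def g_def inner_vec_def)
  have block_psd: "pos_semidef (leading_block (agg_mat Q l)) \<longleftrightarrow> 0 \<le> l v* D" for l
    unfolding pos_semidef_diagonal_iff[OF block_diag]
    by (simp add: leading_block_def agg_Some nonneg_vec_iff)
  have agg_psd: "pos_semidef (agg_mat Q l) \<longleftrightarrow> 0 \<le> l v* D \<and> 0 \<le> l \<bullet> g" for l
    unfolding pos_semidef_diagonal_iff[OF agg_diag]
    by (simp add: split_option_all agg_Some agg_None nonneg_vec_iff conj_commute)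
  have block_zero: "leading_block (agg_mat Q l) = 0 \<longleftrightarrow> l v* D = 0" for l
  proof
    assume "leading_block (agg_mat Q l) = 0"
    then have "agg_mat Q l $ Some j $ Some j = 0" for j
      by (simp add: leading_block_def vec_eq_iff)
    then show "l v* D = 0" by (simp add: vec_eq_iff agg_Some)
  next
    assume zero: "l v* D = 0"
    have "agg_mat Q l $ Some j $ Some k = 0" for j k
    proof (cases "j = k")
      case True
      then show ?thesis using agg_Some[of l k] zero by simp
    next
      case False
      then show ?thesis using agg_diag[of l] by (simp add: is_diagonal_def)
    qed
    then show "leading_block (agg_mat Q l) = 0"
      by (simp add: leading_block_def vec_eq_iff)
  qed
  have agg_one_neg: "num_neg_eigenvalues (agg_mat Q l) \<le> 1" if "0 \<le> l v* D" for l
  proof -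
    have "{p. agg_mat Q l $ p $ p < 0} \<subseteq> {None}"
    proof
      fix p assume "p \<in> {p. agg_mat Q l $ p $ p < 0}"
      then show "p \<in> {None}"
        using that by (cases p) (auto simp: agg_Some nonneg_vec_iff not_less[symmetric])
    qed
    then have "card {p. agg_mat Q l $ p $ p < 0} \<le> card {None :: 'n option}"
      by (intro card_mono) auto
    then show ?thesis by (simp add: num_neg_eigenvalues_diagonal[OF agg_diag])
  qed

  have hull_iff: "x \<in> convex hull S \<longleftrightarrow> (\<forall>l\<in>psd_multipliers D. x \<in> agg_set f l)" for x
    unfolding S_sq agg_sq mem_Collect_eq by (rule convex_hull_diagonal_system)
  have S_agg: "S \<subseteq> agg_set f l" if "0 \<le> l" "l \<noteq> 0" for l
    using that by (auto simp: S_sq agg_sq intro: inner_neg_of_nonneg_nonzero)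

  have part1: "S = {} \<longleftrightarrow> (\<exists>l::real^'m. 0 \<le> l \<and> l \<noteq> 0 \<and> pos_semidef (agg_mat Q l))"
  proof -
    have "S \<noteq> {} \<longleftrightarrow> (\<exists>w. 0 \<le> w \<and> (\<forall>i. (D *v w + g) $ i < 0))"
    proof
      assume "S \<noteq> {}"
      then show "\<exists>w. 0 \<le> w \<and> (\<forall>i. (D *v w + g) $ i < 0)"
        unfolding S_sq using vec_sq_nonneg by blast
    next
      assume "\<exists>w. 0 \<le> w \<and> (\<forall>i. (D *v w + g) $ i < 0)"
      then obtain w where w: "0 \<le> w" "\<forall>i. (D *v w + g) $ i < 0" by blast
      then obtain x where "vec_sq x = w" using nonneg_is_vec_sq by blast
      then show "S \<noteq> {}" unfolding S_sq using w(2) by blast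
    qed
    then show ?thesis
      unfolding strict_system_alternative agg_psd by blast
  qed

  have psd_agg: "convex (agg_set f l) \<and> agg_set f l \<noteq> UNIV"
    if "0 \<le> l v* D" "l v* D \<noteq> 0" for l
    unfolding agg_sq
    using that convex_psd_multiplier_sublevel psd_multiplier_sublevel_neq_UNIV by blast
  have hull_proper: "convex hull S \<noteq> UNIV"
    if "0 \<le> l" "l \<noteq> 0" "convex (agg_set f l)" "agg_set f l \<noteq> UNIV" for l
    using hull_minimal[of S "agg_set f l" convex, OF S_agg] that by blast
  have psd_block_exists: "\<exists>l. 0 \<le> l \<and> l v* D \<noteq> 0 \<and> 0 \<le> l v* D"
    if nonempty: "S \<noteq> {}" and proper: "convex hull S \<noteq> UNIV"
  proof -
    obtain x l where l: "l \<in> psd_multipliers D" and x: "x \<notin> agg_set f l"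
      using proper hull_iff by blast
    obtain s where "s \<in> S" using nonempty by blast
    then have s: "s \<in> agg_set f l"
      using S_agg l by (auto simp: psd_multipliers_def)
    (* Otherwise the aggregation is the constant l \<bullet> g, so it cannot separate s from x. *)
    have "l v* D \<noteq> 0"
      using s x by (auto simp: agg_sq inner_add_right dot_lmul_matrix[symmetric])
    then show ?thesis using l by (auto simp: psd_multipliers_def)
  qed
  have part2a: "convex hull S \<noteq> UNIV \<longleftrightarrow>
      (\<exists>l::real^'m. 0 \<le> l \<and> leading_block (agg_mat Q l) \<noteq> 0
        \<and> pos_semidef (leading_block (agg_mat Q l)))" if "S \<noteq> {}"
    unfolding block_zero block_psd
  proof
    show "\<exists>l. 0 \<le> l \<and> l v* D \<noteq> 0 \<and> 0 \<le> l v* D" if "convex hull S \<noteq> UNIV"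
      using psd_block_exists \<open>S \<noteq> {}\<close> that by blast
  next
    assume "\<exists>l. 0 \<le> l \<and> l v* D \<noteq> 0 \<and> 0 \<le> l v* D"
    then obtain l where l: "0 \<le> l" "l v* D \<noteq> 0" "0 \<le> l v* D" by blast
    then have "l \<noteq> 0" by auto
    then show "convex hull S \<noteq> UNIV" using hull_proper[of l] psd_agg l by blast
  qed
  have part2b: "convex hull S \<noteq> UNIV \<longleftrightarrow>
      (\<exists>l::real^'m. 0 \<le> l \<and> l \<noteq> 0 \<and> convex (agg_set f l) \<and> agg_set f l \<noteq> UNIV)"
    if "S \<noteq> {}"
  proof
    assume "convex hull S \<noteq> UNIV"
    then obtain l where l: "0 \<le> l" "l v* D \<noteq> 0" "0 \<le> l v* D"
      using psd_block_exists \<open>S \<noteq> {}\<close> by blast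
    then have "l \<noteq> 0" by auto
    then show "\<exists>l::real^'m. 0 \<le> l \<and> l \<noteq> 0 \<and> convex (agg_set f l) \<and> agg_set f l \<noteq> UNIV"
      using l psd_agg by blast
  qed (use hull_proper in blast)

  have part3: "\<exists>L::(real^'m) set. finite L \<and> L \<subseteq> good_aggs f Q
      \<and> (\<forall>l\<in>L. pos_semidef (leading_block (agg_mat Q l)))
      \<and> convex hull S = (\<Inter>l\<in>L. agg_set f l)"
  proof -
    obtain V where V: "finite V" "V \<subseteq> psd_multipliers D"
      "\<And>l. l \<in> psd_multipliers D \<Longrightarrow> \<exists>s>0. s *\<^sub>R l \<in> convex hull V"
      using psd_multipliers_finitely_generated by blast
    (* At fixed x the aggregated value is linear in the multiplier, so negativity on V passes to
       the hull of V and from there, by scaling, to the whole cone. *)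
    have "x \<in> convex hull S" if x: "\<And>v. v \<in> V \<Longrightarrow> x \<in> agg_set f v" for x
      unfolding hull_iff
    proof
      fix l assume "l \<in> psd_multipliers D"
      then obtain s where s: "0 < s" "s *\<^sub>R l \<in> convex hull V" using V(3) by blast
      have "V \<subseteq> {l. (D *v vec_sq x + g) \<bullet> l < 0}"
        using x by (auto simp: agg_sq inner_commute)
      then have "convex hull V \<subseteq> {l. (D *v vec_sq x + g) \<bullet> l < 0}"
        by (rule hull_minimal) (rule convex_halfspace_lt)
      then show "x \<in> agg_set f l"
        using s by (auto simp: agg_sq inner_commute mult_less_0_iff)
    qed
    moreover have hull_sub: "convex hull S \<subseteq> agg_set f v" if "v \<in> V" for v
    proof
      fix x assume "x \<in> convex hull S"
      then show "x \<in> agg_set f v"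
        using that V(2) unfolding hull_iff by (metis subsetD)
    qed
    ultimately have "convex hull S = (\<Inter>l\<in>V. agg_set f l)"
      by (intro equalityI subsetI INT_I) (simp_all add: subset_iff)
    moreover have "V \<subseteq> good_aggs f Q"
    proof
      fix v assume "v \<in> V"
      then have "0 \<le> v" "v \<noteq> 0" "0 \<le> v v* D"
        using V(2) by (auto simp: psd_multipliers_def)
      then show "v \<in> good_aggs f Q"
        using hull_sub[OF \<open>v \<in> V\<close>] agg_one_neg[of v] by (simp add: good_aggs_def S_eq)
    qed
    moreover have "\<forall>l\<in>V. pos_semidef (leading_block (agg_mat Q l))"
      using V(2) by (auto simp: block_psd psd_multipliers_def)
    ultimately show ?thesis using V(1) by blast
  qed
  show ?thesis
    using part1 part2a part2b part3 by blast
qed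

end
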